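(* Let $(j,k)\in\mathcal P$ be a comparable pair, and suppose that the Continuity of Types, Sharp Local Preference Sets, and Distribution of Local Preference Sets assumptions (stated in the context) hold. Then the sharp set of all possible discrete probability distributions of $Q_j$ conditional on $S_j=c_j$ is the set of all probability mass functions on $\mathcal J^0\times\mathcal J^0$ such that, for every $A\in\mathbf\Lambda_j^{\cup+}\cup\mathbf\Lambda_j^{\cup-}$, the implied value of $\mathbb P[Q_j\in A\mid S_j=c_j]$ satisfies: (i) if $A\in\mathbf\Lambda_j^{\cup+}\cap\mathbf\Lambda_j^{\cup-}$, $$\mathbb P[Q_j\in A\mid S_j=c_j]\ \ge\ \max\big\{\mathbb P[\mathbf Q_j\subseteq A\mid S_j=c_j^+],\ \mathbb P[\mathbf Q_j\subseteq A\mid S_j=c_j^-]\big\};$$ (ii) if $A\in\mathbf\Lambda_j^{\cup+}\setminus\mathbf\Lambda_j^{\cup-}$, $$\mathbb P[Q_j\in A\mid S_j=c_j]\ \ge\ \mathbb P[\mathbf Q_j\subseteq A\mid S_j=c_j^+];$$ (iii) if $A\in\mathbf\Lambda_j^{\cup-}\setminus\mathbf\Lambda_j^{\cup+}$, $$\mathbb P[Q_j\in A\mid S_j=c_j]\ \ge\ \mathbb P[\mathbf Q_j\subseteq A\mid S_j=c_j^-].$$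
   Context: Setting. $\mathcal J=\{1,\dots,J\}$ is a finite set of schools and $\mathcal J^0=\mathcal J\cup\{0\}$, where $0$ is the outside option. $(\Omega,\mathbb P)$ is a probability space of student types. Each student $\omega$ has: a strict preference relation (strict linear order) $Q(\omega)$ on $\mathcal J^0$ ranking at least one school above $0$ ($\mathcal Q$ is the finite set of all such relations); a vector of placement scores $\mathbf S(\omega)=(S_1(\omega),\dots,S_J(\omega))\in\mathbb R^J$; and real potential outcomes $Y(\omega,d)$, written $Y(d)$, for $d\in\mathcal J^0$. There are fixed cutoffs $c_1,\dots,c_J$. Each $S_j$ has an absolutely continuous distribution with support $\mathcal S_j$ containing a closed interval around $c_j$. For any two scores, either $\mathbb P[S_j=S_l]=1$ (the two schools use the same score; the scores are then identified as functions on $\Omega$) or $\mathbb P[f(S_j)=S_l]<1$ for every measurable $f$. Conditioning on $S_j=s$ refers to a fixed regular conditional distribution given $S_j$, concentrated on $\{S_j=s\}$; all expectations written are assumed to exist. $S_j=c_j^+$ (resp. $c_j^-$) in a conditioning denotes the limit of the quantity conditional on $S_j=s$ as $s\downarrow c_j$ (resp. $s\uparrow c_j$). Budget sets and local preferences. $B(\mathbf S)=\{0\}\cup\{m\in\mathcal J:S_m\ge c_m\}$. Let $E_j$ be the set of schools $m$ that use the same placement score as $j$ ($S_m=S_j$) and have $c_m=c_j$. $B_j^+(\mathbf S)=B(\mathbf S)\cup E_j$, $B_j^-(\mathbf S)=B(\mathbf S)\setminus E_j$. For nonempty $B\subseteq\mathcal J^0$, $Q(B)$ is the most preferred element of $B$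 under $Q$. $Q_j=(Q(B_j^+(\mathbf S)),Q(B_j^-(\mathbf S)))$. Students are matched to $\mu=Q(B(\mathbf S))$ and the observed outcome is $Y=Y(\mu)$. Comparable pairs. $\mathcal P$ is the set of pairs $(j,k)\in\mathcal J\times\mathcal J$, $j\ne k$, such that $c_j$ is an interior point of $\mathcal S_j$ and $\mathbb P[Q_j=(j,k)\mid S_j=s]$ is bounded away from zero for $s$ in an open neighborhood of $c_j$. Local preference sets. For each student near the cutoff there is a set $\mathbf Q_j\subseteq\mathcal J^0\times\mathcal J^0$ (a random set). $\mathbf\Lambda_j(s)=\{B\subseteq\mathcal J^0\times\mathcal J^0:\mathbb P[\mathbf Q_j=B\mid S_j=s]>0\}$. The union set of a collection is the collection of all unions of its members. Continuity of Types. Let $\mathbf S_{-j}=(S_m)_{m\ne j}$ and let $\mathbf A_{-j}$ be the collection of the $2^{J-1}$ events on $\mathbf S_{-j}$ obtained by specifying, for each $m\neq j$, either $S_m\ge c_m$ or $S_m<c_m$. $\mathcal G$ is a set of measurable functions $g:\mathbb R\to\mathbb R$ containing the constant $1$ and the identity. The following are continuous in $s$ at $s=c_j$: (i) $\mathbb P[\mathbf S_{-j}\in A_0,Q=Q_0\mid S_j=s]$ for all $A_0\in\mathbf A_{-j}$, $Q_0\in\mathcal Q$; (ii) $\mathbb E[g(Y(d))\,\mathbb I\{\mathbf S_{-j}\in A_0,Q=Q_0\}\mid S_j=s]$ for all $A_0\in\mathbf A_{-j}$, $Q_0\in\mathcal Q$, $g\in\mathcal G$, $d\in\mathcal J^0$.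 Sharp Local Preference Sets. (i) $Q_j$ and $\mathbf Q_j$ are measurable on the same probability space and $\mathbb P[Q_j\in\mathbf Q_j\mid S_j]=1$ with probability 1; (ii) the support of the distribution of $Q_j$ conditional on $(\mathbf Q_j,S_j)$ equals $\mathbf Q_j$ with probability 1. Distribution of Local Preference Sets. (i) There are $\varepsilon>0$ and collections $\mathbf\Lambda_j^+,\mathbf\Lambda_j^-$ of subsets of $\mathcal J^0\times\mathcal J^0$ with $\mathbf\Lambda_j^+=\mathbf\Lambda_j(c_j+e)$ for all $e\in[0,\varepsilon)$ and $\mathbf\Lambda_j^-=\mathbf\Lambda_j(c_j-e)$ for all $e\in(0,\varepsilon)$; $\mathbf\Lambda_j^{\cup+},\mathbf\Lambda_j^{\cup-}$ denote their union sets. (ii) For any $g\in\mathcal G$ and $-\infty\le\underline\tau<\overline\tau\le+\infty$, the one-sided limits $\mathbb E[g(Y)\mathbb I\{\mathbf Q_j=A,\underline\tau<g(Y)<\overline\tau\}\mid S_j=c_j^+]$ for $A\in\mathbf\Lambda_j^+$ and $\mathbb E[g(Y)\mathbb I\{\mathbf Q_j=A,\underline\tau<g(Y)<\overline\tau\}\mid S_j=c_j^-]$ for $A\in\mathbf\Lambda_j^-$ are well defined. Meaning of "sharp set of all possible distributions": the set of probability mass functions $p$ on $\mathcal J^0\times\mathcal J^0$ that are, for both one-sided limit distributions of $\mathbf Q_j$ (given $S_j=c_j^+$ and given $S_j=c_j^-$), the distribution of a selection, i.e. for each sign there is a coupling of some $q\sim p$ with a random set $\mathbf q$ having that limit distribution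 such that $q\in\mathbf q$ almost surely. The true conditional distribution of $Q_j$ given $S_j=c_j$ belongs to this set. *)

theory Defs
  imports "HOL-Probability.Probability"
begin

text \<open>
  Primitives of the model. Schools are \<open>1, \<dots>, J\<close>, with \<open>J = n_schools E\<close>, and \<open>0\<close> is the
  outside option. \<open>(a, b) \<in> pref E \<omega>\<close> means that student \<open>\<omega>\<close> strictly prefers \<open>a\<close> to \<open>b\<close>.
  \<open>kern E j s\<close> is the fixed version of the conditional law on the space of students given
  that the \<open>j\<close>-th score equals \<open>s\<close>. \<open>test_funs E\<close> is the class of functions \<open>g\<close> of the
  outcome.
\<close>

record 'w market =
  students :: "'w measure"
  n_schools :: nat
  pref :: "'w \<Rightarrow> nat rel"
  score :: "nat \<Rightarrow> 'w \<Rightarrow> real"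
  cutoff :: "nat \<Rightarrow> real"
  pot_outcome :: "nat \<Rightarrow> 'w \<Rightarrow> real"
  kern :: "nat \<Rightarrow> real \<Rightarrow> 'w measure"
  test_funs :: "(real \<Rightarrow> real) set"

definition schools :: "('w, 'z) market_scheme \<Rightarrow> nat set" where
  "schools E = {1..n_schools E}"

definition options :: "('w, 'z) market_scheme \<Rightarrow> nat set" where
  "options E = insert 0 (schools E)"

definition pref_rels :: "('w, 'z) market_scheme \<Rightarrow> nat rel set" where
  "pref_rels E = {r. r \<subseteq> options E \<times> options E \<and> strict_linear_order_on (options E) r \<and>
                     (\<exists>m\<in>schools E. (m, 0) \<in> r)}"

definition measure_support :: "real measure \<Rightarrow> real set" where
  "measure_support N = {s. \<forall>U. open U \<longrightarrow> s \<in> U \<longrightarrow> 0 < emeasure N U}"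

definition score_law :: "('w, 'z) market_scheme \<Rightarrow> nat \<Rightarrow> real measure" where
  "score_law E j = distr (students E) borel (score E j)"

definition score_support :: "('w, 'z) market_scheme \<Rightarrow> nat \<Rightarrow> real set" where
  "score_support E j = measure_support (score_law E j)"

definition cprob :: "('w, 'z) market_scheme \<Rightarrow> nat \<Rightarrow> ('w \<Rightarrow> bool) \<Rightarrow> real \<Rightarrow> real" where
  "cprob E j P s = measure (kern E j s) {\<omega> \<in> space (students E). P \<omega>}"

definition cexp :: "('w, 'z) market_scheme \<Rightarrow> nat \<Rightarrow> ('w \<Rightarrow> real) \<Rightarrow> real \<Rightarrow> real" where
  "cexp E j X s = integral\<^sup>L (kern E j s) X"

text \<open>
  Probability given \<open>S\<^sub>j = c\<^sub>j\<^sup>+\<close> and given \<open>S\<^sub>j = c\<^sub>j\<^sup>-\<close>; meaningful when the limit exists.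
\<close>

definition cprob_right :: "('w, 'z) market_scheme \<Rightarrow> nat \<Rightarrow> ('w \<Rightarrow> bool) \<Rightarrow> real" where
  "cprob_right E j P = Lim (at_right (cutoff E j)) (cprob E j P)"

definition cprob_left :: "('w, 'z) market_scheme \<Rightarrow> nat \<Rightarrow> ('w \<Rightarrow> bool) \<Rightarrow> real" where
  "cprob_left E j P = Lim (at_left (cutoff E j)) (cprob E j P)"

text \<open>
  The kernel is a regular conditional distribution given \<open>S\<^sub>j\<close>. Its values off the support of
  \<open>S\<^sub>j\<close> are irrelevant, and there the fibre \<open>{S\<^sub>j = s}\<close> may be empty, so concentration on the
  fibre is only asked for on the support.
\<close>

definition regular_cond_dist :: "('w, 'z) market_scheme \<Rightarrow> nat \<Rightarrow> bool" where
  "regular_cond_dist E j \<longleftrightarrow>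
     kern E j \<in> borel \<rightarrow>\<^sub>M prob_algebra (students E) \<and>
     (\<forall>A\<in>sets (students E). \<forall>T\<in>sets borel.
        emeasure (students E) (A \<inter> {\<omega> \<in> space (students E). score E j \<omega> \<in> T}) =
        (\<integral>\<^sup>+s\<in>T. emeasure (kern E j s) A \<partial>score_law E j)) \<and>
     (\<forall>s\<in>score_support E j. AE \<omega> in kern E j s. score E j \<omega> = s)"

text \<open>
  In the condition on pairs of scores, the first alternative is \<open>P[S\<^sub>j = S\<^sub>l] = 1\<close> together with
  the convention that almost surely equal scores are identified as functions.
\<close>

definition valid_market :: "('w, 'z) market_scheme \<Rightarrow> bool" where
  "valid_market E \<longleftrightarrow>
     prob_space (students E) \<and>
     pref E \<in> students E \<rightarrow>\<^sub>M count_space (pref_rels E) \<and>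
     (\<forall>d\<in>options E. pot_outcome E d \<in> borel_measurable (students E)) \<and>
     (\<forall>j\<in>schools E.
        score E j \<in> borel_measurable (students E) \<and>
        absolutely_continuous lborel (score_law E j) \<and>
        (\<exists>\<delta>>0. {cutoff E j - \<delta> .. cutoff E j + \<delta>} \<subseteq> score_support E j) \<and>
        regular_cond_dist E j) \<and>
     (\<forall>j\<in>schools E. \<forall>l\<in>schools E.
        (\<forall>\<omega>\<in>space (students E). score E j \<omega> = score E l \<omega>) \<or>
        (\<forall>f\<in>borel_measurable borel.
           measure (students E) {\<omega> \<in> space (students E). f (score E j \<omega>) = score E l \<omega>} < 1)) \<and>
     test_funs E \<subseteq> borel_measurable borel \<and>
     (\<lambda>_. 1) \<in> test_funs E \<and> (\<lambda>y. y) \<in> test_funs E"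

definition budget :: "('w, 'z) market_scheme \<Rightarrow> 'w \<Rightarrow> nat set" where
  "budget E \<omega> = insert 0 {m \<in> schools E. cutoff E m \<le> score E m \<omega>}"

definition same_cutoff_schools :: "('w, 'z) market_scheme \<Rightarrow> nat \<Rightarrow> nat set" where
  "same_cutoff_schools E j =
     {m \<in> schools E. (\<forall>\<omega>\<in>space (students E). score E m \<omega> = score E j \<omega>) \<and>
                     cutoff E m = cutoff E j}"

definition budget_plus :: "('w, 'z) market_scheme \<Rightarrow> nat \<Rightarrow> 'w \<Rightarrow> nat set" where
  "budget_plus E j \<omega> = budget E \<omega> \<union> same_cutoff_schools E j"

definition budget_minus :: "('w, 'z) market_scheme \<Rightarrow> nat \<Rightarrow> 'w \<Rightarrow> nat set" where
  "budget_minus E j \<omega> = budget E \<omega> - same_cutoff_schools E j"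

definition most_preferred :: "nat rel \<Rightarrow> nat set \<Rightarrow> nat" where
  "most_preferred r B = (THE a. a \<in> B \<and> (\<forall>b\<in>B. b \<noteq> a \<longrightarrow> (a, b) \<in> r))"

definition local_pref :: "('w, 'z) market_scheme \<Rightarrow> nat \<Rightarrow> 'w \<Rightarrow> nat \<times> nat" where
  "local_pref E j \<omega> =
     (most_preferred (pref E \<omega>) (budget_plus E j \<omega>),
      most_preferred (pref E \<omega>) (budget_minus E j \<omega>))"

definition assignment :: "('w, 'z) market_scheme \<Rightarrow> 'w \<Rightarrow> nat" where
  "assignment E \<omega> = most_preferred (pref E \<omega>) (budget E \<omega>)"

definition outcome :: "('w, 'z) market_scheme \<Rightarrow> 'w \<Rightarrow> real" where
  "outcome E \<omega> = pot_outcome E (assignment E \<omega>) \<omega>"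

definition comparable_pairs :: "('w, 'z) market_scheme \<Rightarrow> (nat \<times> nat) set" where
  "comparable_pairs E =
     {(j, k). j \<in> schools E \<and> k \<in> schools E \<and> j \<noteq> k \<and>
        cutoff E j \<in> interior (score_support E j) \<and>
        (\<exists>\<eta>>0. \<exists>U. open U \<and> cutoff E j \<in> U \<and>
           (\<forall>s\<in>U. \<eta> \<le> cprob E j (\<lambda>\<omega>. local_pref E j \<omega> = (j, k)) s))}"

text \<open>
  The events obtained by deciding, for every \<open>m \<noteq> j\<close>, whether \<open>S\<^sub>m \<ge> c\<^sub>m\<close> (\<open>m \<in> T\<close>) or
  \<open>S\<^sub>m < c\<^sub>m\<close> (\<open>m \<notin> T\<close>).
\<close>

definition other_score_events :: "('w, 'z) market_scheme \<Rightarrow> nat \<Rightarrow> 'w set set" where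
  "other_score_events E j =
     {{\<omega> \<in> space (students E). \<forall>m\<in>schools E - {j}. cutoff E m \<le> score E m \<omega> \<longleftrightarrow> m \<in> T} | T.
        T \<subseteq> schools E - {j}}"

text \<open>
  In the following assumptions the integrability clauses express that the conditional
  expectations exist; the Bochner integral of a non-integrable function is \<open>0\<close> by convention.
\<close>

definition continuity_of_types :: "('w, 'z) market_scheme \<Rightarrow> nat \<Rightarrow> bool" where
  "continuity_of_types E j \<longleftrightarrow>
     (\<forall>A\<in>other_score_events E j. \<forall>r\<in>pref_rels E.
        isCont (cprob E j (\<lambda>\<omega>. \<omega> \<in> A \<and> pref E \<omega> = r)) (cutoff E j)) \<and>
     (\<forall>A\<in>other_score_events E j. \<forall>r\<in>pref_rels E. \<forall>g\<in>test_funs E. \<forall>d\<in>options E.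
        let X = (\<lambda>\<omega>. g (pot_outcome E d \<omega>) * of_bool (\<omega> \<in> A \<and> pref E \<omega> = r)) in
        (\<forall>\<^sub>F s in nhds (cutoff E j). integrable (kern E j s) X) \<and>
        isCont (cexp E j X) (cutoff E j))"

text \<open>
  Local preference sets exist for students near the cutoff only. The random set \<open>R\<close> is a
  function on all students, but its values outside a neighbourhood of the cutoff are
  unconstrained.
\<close>

definition sharp_local_pref_sets ::
    "('w, 'z) market_scheme \<Rightarrow> nat \<Rightarrow> ('w \<Rightarrow> (nat \<times> nat) set) \<Rightarrow> bool" where
  "sharp_local_pref_sets E j R \<longleftrightarrow>
     local_pref E j \<in> students E \<rightarrow>\<^sub>M count_space (options E \<times> options E) \<and>
     R \<in> students E \<rightarrow>\<^sub>M count_space (Pow (options E \<times> options E)) \<and>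
     (\<exists>\<delta>>0.
        (AE \<omega> in students E. \<bar>score E j \<omega> - cutoff E j\<bar> < \<delta> \<longrightarrow>
           cprob E j (\<lambda>\<omega>'. local_pref E j \<omega>' \<in> R \<omega>') (score E j \<omega>) = 1) \<and>
        (AE \<omega> in students E. \<bar>score E j \<omega> - cutoff E j\<bar> < \<delta> \<longrightarrow>
           {q \<in> options E \<times> options E.
              0 < real_cond_exp (students E)
                    (vimage_algebra (space (students E)) (\<lambda>\<omega>'. (R \<omega>', score E j \<omega>'))
                       (count_space (Pow (options E \<times> options E)) \<Otimes>\<^sub>M borel))
                    (\<lambda>\<omega>'. of_bool (local_pref E j \<omega>' = q)) \<omega>} = R \<omega>))"

definition lps_support ::
    "('w, 'z) market_scheme \<Rightarrow> nat \<Rightarrow> ('w \<Rightarrow> (nat \<times> nat) set) \<Rightarrow> real \<Rightarrow> (nat \<times> nat) set set" where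
  "lps_support E j R s = {B. B \<subseteq> options E \<times> options E \<and> 0 < cprob E j (\<lambda>\<omega>. R \<omega> = B) s}"

definition lps_moment ::
    "('w, 'z) market_scheme \<Rightarrow> ('w \<Rightarrow> (nat \<times> nat) set) \<Rightarrow> (real \<Rightarrow> real) \<Rightarrow> ereal \<Rightarrow> ereal \<Rightarrow>
       (nat \<times> nat) set \<Rightarrow> 'w \<Rightarrow> real" where
  "lps_moment E R g lo hi A \<omega> =
     g (outcome E \<omega>) *
     of_bool (R \<omega> = A \<and> lo < ereal (g (outcome E \<omega>)) \<and> ereal (g (outcome E \<omega>)) < hi)"

definition one_sided_limit_exists ::
    "('w, 'z) market_scheme \<Rightarrow> nat \<Rightarrow> real filter \<Rightarrow> ('w \<Rightarrow> real) \<Rightarrow> bool" where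
  "one_sided_limit_exists E j F X \<longleftrightarrow>
     (\<forall>\<^sub>F s in F. integrable (kern E j s) X) \<and> (\<exists>L. (cexp E j X \<longlongrightarrow> L) F)"

definition dist_local_pref_sets ::
    "('w, 'z) market_scheme \<Rightarrow> nat \<Rightarrow> ('w \<Rightarrow> (nat \<times> nat) set) \<Rightarrow>
       (nat \<times> nat) set set \<Rightarrow> (nat \<times> nat) set set \<Rightarrow> bool" where
  "dist_local_pref_sets E j R \<Lambda>p \<Lambda>m \<longleftrightarrow>
     (\<exists>\<epsilon>>0. (\<forall>e. 0 \<le> e \<and> e < \<epsilon> \<longrightarrow> lps_support E j R (cutoff E j + e) = \<Lambda>p) \<and>
            (\<forall>e. 0 < e \<and> e < \<epsilon> \<longrightarrow> lps_support E j R (cutoff E j - e) = \<Lambda>m)) \<and>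
     (\<forall>g\<in>test_funs E. \<forall>lo hi. lo < hi \<longrightarrow>
        (\<forall>A\<in>\<Lambda>p. one_sided_limit_exists E j (at_right (cutoff E j)) (lps_moment E R g lo hi A)) \<and>
        (\<forall>A\<in>\<Lambda>m. one_sided_limit_exists E j (at_left (cutoff E j)) (lps_moment E R g lo hi A)))"

definition union_set :: "'a set set \<Rightarrow> 'a set set" where
  "union_set \<Lambda> = {\<Union>\<C> | \<C>. \<C> \<subseteq> \<Lambda> \<and> \<C> \<noteq> {}}"

text \<open>
  \<open>p\<close> is the law of a selection of a random set whose law is the limit, along \<open>F\<close>, of the
  conditional laws of \<open>R\<close> given \<open>S\<^sub>j = s\<close>. The coupling is the joint law \<open>W\<close>.
\<close>

definition selection_law ::
    "('w, 'z) market_scheme \<Rightarrow> nat \<Rightarrow> ('w \<Rightarrow> (nat \<times> nat) set) \<Rightarrow> real filter \<Rightarrow>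
       (nat \<times> nat) pmf \<Rightarrow> bool" where
  "selection_law E j R F p \<longleftrightarrow>
     (\<exists>W :: ((nat \<times> nat) \<times> (nat \<times> nat) set) pmf.
        map_pmf fst W = p \<and>
        (\<forall>B. (cprob E j (\<lambda>\<omega>. R \<omega> = B) \<longlongrightarrow> pmf (map_pmf snd W) B) F) \<and>
        (AE (q, b) in measure_pmf W. q \<in> b))"

definition sharp_set ::
    "('w, 'z) market_scheme \<Rightarrow> nat \<Rightarrow> ('w \<Rightarrow> (nat \<times> nat) set) \<Rightarrow> (nat \<times> nat) pmf set" where
  "sharp_set E j R =
     {p. set_pmf p \<subseteq> options E \<times> options E \<and>
         selection_law E j R (at_right (cutoff E j)) p \<and>
         selection_law E j R (at_left (cutoff E j)) p}"

definition is_true_law :: "('w, 'z) market_scheme \<Rightarrow> nat \<Rightarrow> (nat \<times> nat) pmf \<Rightarrow> bool" where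
  "is_true_law E j p \<longleftrightarrow>
     (\<forall>q. pmf p q = cprob E j (\<lambda>\<omega>. local_pref E j \<omega> = q) (cutoff E j))"

end

theory Submission
  imports Defs
begin

text \<open>
  The moments with \<open>g = 1\<close> and infinite truncation points show that the law of the local preference
  set given \<open>S\<^sub>j = s\<close> converges as \<open>s\<close> approaches the cutoff from either side. By the finite version
  of Strassen's theorem, \<open>p\<close> is the law of a selection of a random set with law \<open>N\<close> iff
  \<open>N {B. B \<subseteq> A} \<le> p A\<close> for all \<open>A\<close>, and only unions of sets charged by \<open>N\<close> matter, since
  replacing \<open>A\<close> by the union of the charged subsets of \<open>A\<close> leaves the left-hand side unchanged.
  The true law qualifies because the inequalities hold at scores arbitrarily close to the cutoff on
  each side, and the law of \<open>Q\<^sub>j\<close> is continuous there by continuity of types.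

  Strassen's theorem itself comes from Hall's condition for real supplies and capacities: mass is
  pushed along an edge until a supply or a capacity is exhausted or some proper set of sources
  becomes tight, in which case the problem splits in two.
\<close>

section \<open>Transport on finite bipartite graphs\<close>

text \<open>Supplies are met exactly while capacities are only upper bounds; equality at the sinks
  is recovered later from equal total mass. Off \<open>X\<close> and \<open>Y\<close> the flow
  \<open>f\<close> is restricted only by its sign and by \<open>G\<close>.\<close>

definition has_transport where
  "has_transport G X Y a b \<longleftrightarrow> (\<exists>f :: 'x \<Rightarrow> 'y \<Rightarrow> real.
     (\<forall>x y. 0 \<le> f x y) \<and> (\<forall>x y. f x y \<noteq> 0 \<longrightarrow> G x y) \<and>
     (\<forall>x\<in>X. (\<Sum>y\<in>Y. f x y) = a x) \<and> (\<forall>y\<in>Y. (\<Sum>x\<in>X. f x y) \<le> b y))"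

text \<open>Hall's marriage condition with weights. Finiteness and nonnegativity are bundled in so
  that the induction carries a single hypothesis.\<close>

definition hall_condition where
  "hall_condition G X Y a b \<longleftrightarrow> finite X \<and> finite Y \<and>
     (\<forall>x\<in>X. (0::real) \<le> a x) \<and> (\<forall>y\<in>Y. 0 \<le> b y) \<and>
     (\<forall>S. S \<subseteq> X \<longrightarrow> sum a S \<le> sum b {y\<in>Y. \<exists>x\<in>S. G x y})"

text \<open>The smaller transport may carry anything in the row of \<open>x\<close>, so that row is
  reset to zero; this meets the supply 0 and adds no load to any sink.\<close>

lemma has_transport_drop_source:
  assumes "finite X" "has_transport G (X - {x}) Y a b" "a x = 0"
  shows "has_transport G X Y a b"
proof -
  obtain f where f: "\<And>u v. (0::real) \<le> f u v" "\<And>u v. f u v \<noteq> 0 \<Longrightarrow> G u v"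
    "\<And>u. u \<in> X - {x} \<Longrightarrow> (\<Sum>y\<in>Y. f u y) = a u" "\<And>v. v \<in> Y \<Longrightarrow> (\<Sum>u\<in>X-{x}. f u v) \<le> b v"
    using assms(2) unfolding has_transport_def by blast
  have "(\<Sum>u\<in>X. if u = x then 0 else f u v) = (\<Sum>u\<in>X-{x}. f u v)" for v
    using assms(1) by (intro sum.mono_neutral_cong_right) auto
  moreover have "(\<Sum>v\<in>Y. if u = x then 0 else f u v) = a u" if "u \<in> X" for u
    using f(3)[of u] assms(3) that by (cases "u = x") auto
  ultimately show ?thesis unfolding has_transport_def
    using f
    by (intro exI[of _ "\<lambda>u v. if u = x then 0 else f u v"] conjI ballI allI)
       auto
qed

lemma has_transport_drop_sink:
  assumes "finite Y" "has_transport G X (Y - {y}) a b" "b y = 0"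
  shows "has_transport G X Y a b"
proof -
  obtain f where f: "\<And>u v. (0::real) \<le> f u v" "\<And>u v. f u v \<noteq> 0 \<Longrightarrow> G u v"
    "\<And>u. u \<in> X \<Longrightarrow> (\<Sum>v\<in>Y-{y}. f u v) = a u" "\<And>v. v \<in> Y-{y} \<Longrightarrow> (\<Sum>u\<in>X. f u v) \<le> b v"
    using assms(2) unfolding has_transport_def by blast
  have "(\<Sum>v\<in>Y. if v = y then 0 else f u v) = (\<Sum>v\<in>Y-{y}. f u v)" for u
    using assms(1) by (intro sum.mono_neutral_cong_right) auto
  moreover have "(\<Sum>u\<in>X. if v = y then 0 else f u v) \<le> b v" if "v \<in> Y" for v
    using f(4)[of v] assms(3) that by (cases "v = y") auto
  ultimately show ?thesis unfolding has_transport_def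
    using f
    by (intro exI[of _ "\<lambda>u v. if v = y then 0 else f u v"] conjI ballI allI) auto
qed

text \<open>Routing the sources in \<open>S\<close> only into \<open>T\<close>, and the other
  sources only into \<open>Y - T\<close>, keeps the two transports from interfering. A tight set of
  sources splits the problem in this way.\<close>

lemma has_transport_split:
  assumes "finite X" "finite Y" "S \<subseteq> X" "T \<subseteq> Y"
    "has_transport G S T a b" "has_transport G (X - S) (Y - T) a b"
  shows "has_transport G X Y a b"
proof -
  obtain f where f: "\<And>u v. (0::real) \<le> f u v" "\<And>u v. f u v \<noteq> 0 \<Longrightarrow> G u v"
    "\<And>u. u \<in> S \<Longrightarrow> (\<Sum>v\<in>T. f u v) = a u" "\<And>v. v \<in> T \<Longrightarrow> (\<Sum>u\<in>S. f u v) \<le> b v"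
    using assms(5) unfolding has_transport_def by blast
  obtain g where g: "\<And>u v. (0::real) \<le> g u v" "\<And>u v. g u v \<noteq> 0 \<Longrightarrow> G u v"
    "\<And>u. u \<in> X - S \<Longrightarrow> (\<Sum>v\<in>Y - T. g u v) = a u" "\<And>v. v \<in> Y - T \<Longrightarrow> (\<Sum>u\<in>X - S. g u v) \<le> b v"
    using assms(6) unfolding has_transport_def by blast
  define h where "h u v = (if u \<in> S then if v \<in> T then f u v else 0
    else if v \<in> T then 0 else g u v)" for u v
  have 1: "(\<Sum>v\<in>Y. h u v) = (\<Sum>v\<in>T. f u v)" if "u \<in> S" for u
    using assms(2,4) that by (intro sum.mono_neutral_cong_right) (auto simp: h_def)
  have 2: "(\<Sum>v\<in>Y. h u v) = (\<Sum>v\<in>Y-T. g u v)" if "u \<notin> S" for u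
    using assms(2,4) that by (intro sum.mono_neutral_cong_right) (auto simp: h_def)
  have 3: "(\<Sum>u\<in>X. h u v) = (\<Sum>u\<in>S. f u v)" if "v \<in> T" for v
    using assms(1,3) that by (intro sum.mono_neutral_cong_right) (auto simp: h_def)
  have 4: "(\<Sum>u\<in>X. h u v) = (\<Sum>u\<in>X-S. g u v)" if "v \<notin> T" for v
    using assms(1,3) that by (intro sum.mono_neutral_cong_right) (auto simp: h_def)
  show ?thesis unfolding has_transport_def
  proof (intro exI[of _ h] conjI allI impI ballI)
    fix x assume "x \<in> X" then show "(\<Sum>y\<in>Y. h x y) = a x"
      using 1 2 f(3) g(3) by (cases "x \<in> S") auto
  next
    fix y assume "y \<in> Y" then show "(\<Sum>x\<in>X. h x y) \<le> b y"
      using 3[of y] 4[of y] f(4)[of y] g(4)[of y] by (cases "y \<in> T") auto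
  qed (use f g in \<open>auto simp: h_def split: if_splits\<close>)
qed

text \<open>Returning the pushed amount \<open>t\<close> to the edge from \<open>x\<close> to
  \<open>y\<close> restores the original supply and capacity.\<close>

lemma has_transport_push:
  assumes "finite X" "finite Y" "x \<in> X" "y \<in> Y" "G x y" "0 \<le> t"
    "has_transport G X Y (a(x := a x - t)) (b(y := b y - t))"
  shows "has_transport G X Y a b"
proof -
  obtain f where f: "\<And>u v. (0::real) \<le> f u v" "\<And>u v. f u v \<noteq> 0 \<Longrightarrow> G u v"
    "\<And>u. u \<in> X \<Longrightarrow> (\<Sum>v\<in>Y. f u v) = (a(x := a x - t)) u"
    "\<And>v. v \<in> Y \<Longrightarrow> (\<Sum>u\<in>X. f u v) \<le> (b(y := b y - t)) v"
    using assms(7) unfolding has_transport_def by blast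
  define h where "h u v = f u v + (if u = x \<and> v = y then t else 0)" for u v
  have 1: "(\<Sum>v\<in>Y. h u v) = (\<Sum>v\<in>Y. f u v) + (if u = x then t else 0)" for u
    using assms(2,4) by (simp add: h_def sum.distrib)
  have 2: "(\<Sum>u\<in>X. h u v) = (\<Sum>u\<in>X. f u v) + (if v = y then t else 0)" for v
    using assms(1,3) by (cases "v = y") (simp_all add: h_def sum.distrib)
  show ?thesis unfolding has_transport_def
  proof (intro exI[of _ h] conjI allI impI ballI)
    fix u assume "u \<in> X" then show "(\<Sum>y\<in>Y. h u y) = a u"
      using f(3)[of u] by (auto simp: 1)
  next
    fix v assume "v \<in> Y" then show "(\<Sum>x\<in>X. h x v) \<le> b v"
      using f(4)[of v] by (auto simp: 2 split: if_splits)
  next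
    fix u v show "0 \<le> h u v" using f(1)[of u v] assms(6) by (auto simp: h_def)
  next
    fix u v assume "h u v \<noteq> 0" then show "G u v"
      using f(2)[of u v] assms(5) by (auto simp: h_def split: if_splits)
  qed
qed

lemma sum_fun_upd_minus:
  assumes "finite S"
  shows "sum (a(x := a x - t)) S = sum a S - (if x \<in> S then t else (0::real))"
proof -
  have "a(x := a x - t) = (\<lambda>u. a u - (if u = x then t else 0))" by auto
  then show ?thesis using assms by (simp add: sum_subtractf)
qed

text \<open>Induction on the number of sources and sinks. A push leaves this number unchanged, so
  the induction hypothesis is invoked only on degenerate data, where an exhausted vertex or a tight
  set makes the problem smaller.\<close>

theorem fractional_hall:
  fixes a :: "'x \<Rightarrow> real" and b :: "'y \<Rightarrow> real"
  assumes "hall_condition G X Y a b"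
  shows "has_transport G X Y a b"
  using assms
proof (induction "card X + card Y" arbitrary: X Y a b rule: less_induct)
  case less
  define N where "N Y S = {y\<in>Y. \<exists>x\<in>S. G x y}" for Y :: "'y set" and S
  \<comment> \<open>Stated for fresh \<open>a\<close> and \<open>b\<close>, because it is applied
    both to the given data and to the data left after a push.\<close>
  have degenerate: "has_transport G X Y a b"
    if hall: "hall_condition G X Y a b"
      and deg: "(\<exists>x\<in>X. a x = 0) \<or> (\<exists>y\<in>Y. b y = 0) \<or>
           (\<exists>S. S \<subset> X \<and> S \<noteq> {} \<and> sum b (N Y S) = sum a S)" for a b
  proof -
    have fin: "finite X" "finite Y" using hall by (auto simp: hall_condition_def)
    have nonneg: "\<And>x. x \<in> X \<Longrightarrow> 0 \<le> a x" "\<And>y. y \<in> Y \<Longrightarrow> 0 \<le> b y"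
      using hall by (auto simp: hall_condition_def)
    have le: "sum a S \<le> sum b (N Y S)" if "S \<subseteq> X" for S
      using hall that by (auto simp: hall_condition_def N_def)
    from deg show ?thesis
    proof (elim disjE bexE exE conjE)
      fix x assume x: "x \<in> X" "a x = 0"
      have "hall_condition G (X - {x}) Y a b"
        using fin nonneg le unfolding hall_condition_def N_def by auto
      then have "has_transport G (X - {x}) Y a b"
        using fin x by (intro less.hyps add_strict_right_mono card_Diff1_less)
      then show ?thesis using fin(1) x(2) by (metis has_transport_drop_source)
    next
      fix y assume y: "y \<in> Y" "b y = 0"
      have "sum b (N (Y - {y}) S) = sum b (N Y S)" for S
        using fin y by (intro sum.mono_neutral_left) (auto simp: N_def)
      then have "hall_condition G X (Y - {y}) a b"
        using fin nonneg le unfolding hall_condition_def N_def by auto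
      then have "has_transport G X (Y - {y}) a b"
        using fin y by (intro less.hyps add_strict_left_mono card_Diff1_less)
      then show ?thesis using fin(2) y(2) by (metis has_transport_drop_sink)
    next
      fix S assume S: "S \<subset> X" "S \<noteq> {}" "sum b (N Y S) = sum a S"
      have finS: "finite S" using fin S by (auto intro: finite_subset)
      have "card S < card X" "card (X - S) < card X"
        using S fin by (auto intro!: psubset_card_mono)
      moreover have "card (N Y S) \<le> card Y" "card (Y - N Y S) \<le> card Y"
        using fin by (auto intro!: card_mono simp: N_def)
      ultimately have less_card: "card S + card (N Y S) < card X + card Y"
        "card (X - S) + card (Y - N Y S) < card X + card Y" by linarith+
      have "N (N Y S) T = N Y T" if "T \<subseteq> S" for T
        using that by (auto simp: N_def)
      then have 1: "hall_condition G S (N Y S) a b"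
        using fin finS nonneg le S unfolding hall_condition_def N_def[symmetric]
        by (auto simp: N_def)
      \<comment> \<open>Hall's condition for \<open>T \<union> S\<close>, minus the tight equality
        for \<open>S\<close>, is Hall's condition for \<open>T\<close> with the sinks seen by
        \<open>S\<close> removed.\<close>
      have "sum a T \<le> sum b (N (Y - N Y S) T)" if T: "T \<subseteq> X - S" for T
      proof -
        have "sum a T + sum a S = sum a (T \<union> S)"
          using T finS fin by (intro sum.union_disjoint[symmetric]) (auto intro: finite_subset)
        also have "\<dots> \<le> sum b (N Y (T \<union> S))"
          using T S by (intro le) auto
        also have "N Y (T \<union> S) = N (Y - N Y S) T \<union> N Y S"
          by (auto simp: N_def)
        also have "sum b \<dots> = sum b (N (Y - N Y S) T) + sum b (N Y S)"
          using fin by (intro sum.union_disjoint) (auto simp: N_def)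
        finally show ?thesis using S by simp
      qed
      then have 2: "hall_condition G (X - S) (Y - N Y S) a b"
        using fin nonneg unfolding hall_condition_def N_def by auto
      show ?thesis
        by (rule has_transport_split[OF fin _ _ less.hyps[OF less_card(1) 1] less.hyps[OF less_card(2) 2]])
           (use S in \<open>auto simp: N_def\<close>)
    qed
  qed
  have fin: "finite X" "finite Y" using less.prems by (auto simp: hall_condition_def)
  have nonneg: "\<And>x. x \<in> X \<Longrightarrow> 0 \<le> a x" "\<And>y. y \<in> Y \<Longrightarrow> 0 \<le> b y"
    using less.prems by (auto simp: hall_condition_def)
  have le: "sum a S \<le> sum b (N Y S)" if "S \<subseteq> X" for S
    using less.prems that by (auto simp: hall_condition_def N_def)
  consider "X = {}" | "(\<exists>x\<in>X. a x = 0) \<or> (\<exists>y\<in>Y. b y = 0)"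
    | x where "x \<in> X" "\<forall>x\<in>X. a x \<noteq> 0" "\<forall>y\<in>Y. b y \<noteq> 0" by blast
  then show ?case
  proof cases
    case 1
    then show ?thesis using nonneg
      unfolding has_transport_def by (intro exI[of _ "\<lambda>_ _. 0"]) auto
  next
    case 2
    then show ?thesis using degenerate[OF less.prems] by blast
  next
    case (3 x)
    \<comment> \<open>Supplies are now nonzero, hence \<open>a x\<close> is positive, and Hall's
      condition for \<open>{x}\<close> yields an edge out of \<open>x\<close> to push along.\<close>
    have "0 < sum b (N Y {x})"
      using le[of "{x}"] nonneg(1)[of x] 3 by force
    then have "N Y {x} \<noteq> {}" by auto
    then obtain y where y: "y \<in> Y" "G x y" by (auto simp: N_def)
    define slack where "slack S = sum b (N Y S) - sum a S" for S
    \<comment> \<open>Only sets that see \<open>y\<close> without containing \<open>x\<close> lose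
      slack in a push; a set containing \<open>x\<close> also sees \<open>y\<close> and loses
      \<open>t\<close> on both sides. So \<open>t\<close> below is the largest push that preserves
      Hall's condition.\<close>
    define C where "C = {S. S \<subseteq> X \<and> x \<notin> S \<and> y \<in> N Y S}"
    define t where "t = Min ({a x, b y} \<union> slack ` C)"
    have finC: "finite ({a x, b y} \<union> slack ` C)"
      using fin by (auto simp: C_def intro!: finite_imageI finite_subset[of _ "Pow X"])
    have t_in: "t \<in> {a x, b y} \<union> slack ` C"
      unfolding t_def by (rule Min_in[OF finC]) simp
    have t_le: "t \<le> u" if "u \<in> {a x, b y} \<union> slack ` C" for u
      unfolding t_def using finC that by (rule Min_le)
    have t_nonneg: "0 \<le> t"
      using t_in nonneg 3(1) y(1) le by (auto simp: slack_def C_def)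
    let ?a = "a(x := a x - t)" and ?b = "b(y := b y - t)"
    have finN: "finite (N Y S)" for S using fin by (auto simp: N_def)
    have sums: "sum ?a S = sum a S - (if x \<in> S then t else 0)"
      "sum ?b (N Y S) = sum b (N Y S) - (if y \<in> N Y S then t else 0)" if "S \<subseteq> X" for S
      using sum_fun_upd_minus[of S a x t] sum_fun_upd_minus[OF finN, of b y t S]
        finite_subset[OF that fin(1)] by auto
    have "sum ?a S \<le> sum ?b (N Y S)" if S: "S \<subseteq> X" for S
    proof -
      have "x \<in> S \<Longrightarrow> y \<in> N Y S" using y by (auto simp: N_def)
      moreover have "t \<le> slack S" if "x \<notin> S" "y \<in> N Y S"
        using that S by (intro t_le) (auto simp: C_def)
      ultimately show ?thesis using sums[OF S] le[OF S] by (auto simp: slack_def)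
    qed
    moreover have "t \<le> a x" "t \<le> b y" using t_le by auto
    ultimately have hall: "hall_condition G X Y ?a ?b"
      using fin nonneg unfolding hall_condition_def N_def by auto
    from t_in have "(\<exists>x\<in>X. ?a x = 0) \<or> (\<exists>y\<in>Y. ?b y = 0) \<or>
           (\<exists>S. S \<subset> X \<and> S \<noteq> {} \<and> sum ?b (N Y S) = sum ?a S)"
    proof (elim UnE imageE)
      assume "t \<in> {a x, b y}"
      then show ?thesis using 3(1) y(1) by auto
    next
      \<comment> \<open>A member of \<open>C\<close> is nonempty because it sees \<open>y\<close>
        and proper because it misses \<open>x\<close>; the push has used up its slack, so it is
        tight.\<close>
      fix S assume S: "t = slack S" "S \<in> C"
      then have "S \<subset> X" "S \<noteq> {}" "x \<notin> S" "y \<in> N Y S"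
        using 3(1) by (auto simp: C_def N_def)
      then show ?thesis using S(1) sums[of S] by (intro disjI2 exI[of _ S]) (auto simp: slack_def)
    qed
    then have "has_transport G X Y ?a ?b" by (rule degenerate[OF hall])
    then show ?thesis by (rule has_transport_push[where a = a and b = b and G = G, OF fin 3(1) y t_nonneg])
  qed
qed


section \<open>Couplings of finite laws and selections of random sets\<close>

lemma pmf_of_finite_mass_function:
  fixes f :: "'a \<Rightarrow> real"
  assumes "finite A" "\<And>x. 0 \<le> f x" "\<And>x. x \<notin> A \<Longrightarrow> f x = 0" "sum f A = 1"
  obtains P where "pmf P = f" "set_pmf P \<subseteq> A"
proof -
  have "(\<integral>\<^sup>+x. f x \<partial>count_space UNIV) = (\<Sum>x\<in>A. ennreal (f x))"
    using assms by (intro nn_integral_count_space') auto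
  also have "\<dots> = 1" using assms by simp
  finally have "pmf (embed_pmf f) = f"
    using pmf_embed_pmf[of f] assms(2) by auto
  moreover from this have "set_pmf (embed_pmf f) \<subseteq> A"
    using assms(3) by (metis set_pmf_iff subsetI)
  ultimately show ?thesis by (rule that)
qed

text \<open>The two mass functions serve as supplies and capacities on the supports, and the
  transport between them is the joint law of the coupling.\<close>

theorem rel_pmf_finite_iff_measure:
  assumes "finite (set_pmf p)" "finite (set_pmf q)"
  shows "rel_pmf G p q \<longleftrightarrow>
    (\<forall>S\<subseteq>set_pmf p. measure_pmf.prob p S \<le> measure_pmf.prob q {y. \<exists>x\<in>S. G x y})"
    (is "_ \<longleftrightarrow> ?hall")
proof
  show "rel_pmf G p q \<Longrightarrow> ?hall" by (auto intro: rel_pmf_measureD)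
next
  assume hall: ?hall
  let ?X = "set_pmf p" and ?Y = "set_pmf q"
  \<comment> \<open>Keeping only the neighbours in the support of \<open>q\<close> changes no
    probability and leaves a finite set of sinks.\<close>
  have "sum (pmf p) S \<le> sum (pmf q) {y\<in>?Y. \<exists>x\<in>S. G x y}" if "S \<subseteq> ?X" for S
  proof -
    have "sum (pmf p) S = measure_pmf.prob p S"
      using that assms(1) by (subst measure_measure_pmf_finite) (auto intro: finite_subset)
    also have "\<dots> \<le> measure_pmf.prob q {y. \<exists>x\<in>S. G x y}" using hall that by auto
    also have "\<dots> = measure_pmf.prob q {y\<in>?Y. \<exists>x\<in>S. G x y}"
      by (subst measure_Int_set_pmf[symmetric]) (auto intro!: arg_cong[where f = "measure_pmf.prob q"])
    also have "\<dots> = sum (pmf q) {y\<in>?Y. \<exists>x\<in>S. G x y}"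
      using assms(2) by (subst measure_measure_pmf_finite) auto
    finally show ?thesis .
  qed
  then have "has_transport G ?X ?Y (pmf p) (pmf q)"
    using assms by (intro fractional_hall) (auto simp: hall_condition_def)
  then obtain f where f: "\<And>x y. 0 \<le> f x y" "\<And>x y. f x y \<noteq> 0 \<Longrightarrow> G x y"
    "\<And>x. x \<in> ?X \<Longrightarrow> (\<Sum>y\<in>?Y. f x y) = pmf p x" "\<And>y. y \<in> ?Y \<Longrightarrow> (\<Sum>x\<in>?X. f x y) \<le> pmf q y"
    unfolding has_transport_def by blast
  have total: "(\<Sum>x\<in>?X. \<Sum>y\<in>?Y. f x y) = 1"
    using assms f(3) by (simp add: sum_pmf_eq_1)
  text \<open>Both laws have total mass one, so no capacity is left unused.\<close>
  have sinks: "(\<Sum>x\<in>?X. f x y) = pmf q y" if "y \<in> ?Y" for y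
  proof (rule ccontr)
    assume "(\<Sum>x\<in>?X. f x y) \<noteq> pmf q y"
    then have "(\<Sum>y\<in>?Y. \<Sum>x\<in>?X. f x y) < (\<Sum>y\<in>?Y. pmf q y)"
      using that f(4) assms by (intro sum_strict_mono_ex1) force+
    then show False
      using total assms by (subst (asm) sum.swap) (simp add: sum_pmf_eq_1)
  qed
  \<comment> \<open>The flow is not controlled off the supports, so it is cut off there before being
    read as a mass function.\<close>
  define w where "w = (\<lambda>(x, y). if x \<in> ?X \<and> y \<in> ?Y then f x y else 0)"
  have w: "finite (?X \<times> ?Y)" "\<And>z. 0 \<le> w z" "\<And>z. z \<notin> ?X \<times> ?Y \<Longrightarrow> w z = 0"
    using assms f(1) by (auto simp: w_def split: if_splits)
  have "sum w (?X \<times> ?Y) = 1"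
    using total by (simp add: w_def sum.cartesian_product' cong: sum.cong)
  with w obtain W where W: "pmf W = w" "set_pmf W \<subseteq> ?X \<times> ?Y"
    by (rule pmf_of_finite_mass_function)
  have prob_W: "measure_pmf.prob W A = sum w (A \<inter> ?X \<times> ?Y)" for A
  proof -
    have "measure_pmf.prob W A = measure_pmf.prob W (A \<inter> ?X \<times> ?Y)"
      using W(2) by (intro measure_pmf.finite_measure_eq_AE) (auto simp: AE_measure_pmf_iff)
    then show ?thesis using assms W(1) by (simp add: measure_measure_pmf_finite)
  qed
  have "pmf (map_pmf fst W) x = pmf p x" for x
  proof (cases "x \<in> ?X")
    case True
    then have "fst -` {x} \<inter> ?X \<times> ?Y = {x} \<times> ?Y" by auto
    then have "pmf (map_pmf fst W) x = sum w ({x} \<times> ?Y)" by (simp add: pmf_map prob_W)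
    also have "\<dots> = (\<Sum>y\<in>?Y. w (x, y))"
      using sum.cartesian_product[of "\<lambda>x y. w (x, y)" ?Y "{x}"] by simp
    finally show ?thesis using True f(3) by (simp add: w_def)
  next
    case False
    then have "fst -` {x} \<inter> ?X \<times> ?Y = {}" by auto
    then show ?thesis using False by (simp add: pmf_map prob_W set_pmf_iff)
  qed
  moreover have "pmf (map_pmf snd W) y = pmf q y" for y
  proof (cases "y \<in> ?Y")
    case True
    then have "snd -` {y} \<inter> ?X \<times> ?Y = ?X \<times> {y}" by auto
    then have "pmf (map_pmf snd W) y = sum w (?X \<times> {y})" by (simp add: pmf_map prob_W)
    also have "\<dots> = (\<Sum>x\<in>?X. w (x, y))"
      using sum.cartesian_product[of "\<lambda>x y. w (x, y)" "{y}" ?X] by simp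
    finally show ?thesis using True sinks by (simp add: w_def)
  next
    case False
    then have "snd -` {y} \<inter> ?X \<times> ?Y = {}" by auto
    then show ?thesis using False by (simp add: pmf_map prob_W set_pmf_iff)
  qed
  moreover have "G x y" if "(x, y) \<in> set_pmf W" for x y
    using that f(2)[of x y] by (auto simp: set_pmf_iff W(1) w_def split: if_splits)
  ultimately show "rel_pmf G p q"
    by (intro rel_pmf.intros[of W]) (auto intro: pmf_eqI)
qed

text \<open>Artstein's inequalities. Strassen's condition for a family \<open>S\<close> of sets
  charged by \<open>N\<close> compares \<open>S\<close> with the probability of
  \<open>\<Union>S\<close> under \<open>p\<close>, and every member of \<open>S\<close> is a subset
  of \<open>\<Union>S\<close>; so \<open>A = \<Union>S\<close> is the test set to use.\<close>

lemma rel_pmf_selection_iff: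
  fixes N :: "'a set pmf"
  assumes "finite \<Lambda>" "set_pmf N \<subseteq> \<Lambda>" "finite (set_pmf p)"
  shows "rel_pmf (\<lambda>B q. q \<in> B) N p \<longleftrightarrow>
    (\<forall>A\<in>union_set \<Lambda>. measure_pmf.prob N {B. B \<subseteq> A} \<le> measure_pmf.prob p A)"
    (is "_ \<longleftrightarrow> ?artstein")
proof
  assume rel: "rel_pmf (\<lambda>B q. q \<in> B) N p"
  have "measure_pmf.prob N {B. B \<subseteq> A} \<le> measure_pmf.prob p A" for A
  proof -
    have "measure_pmf.prob N {B. B \<subseteq> A} \<le> measure_pmf.prob p {q. \<exists>B\<in>{B. B \<subseteq> A}. q \<in> B}"
      by (rule rel_pmf_measureD[OF rel])
    also have "\<dots> \<le> measure_pmf.prob p A"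
      by (intro measure_pmf.finite_measure_mono) auto
    finally show ?thesis .
  qed
  then show ?artstein by auto
next
  assume ?artstein
  have "measure_pmf.prob N S \<le> measure_pmf.prob p {q. \<exists>B\<in>S. q \<in> B}"
    if S: "S \<subseteq> set_pmf N" for S
  \<comment> \<open>The empty family is treated apart because \<open>union_set\<close> admits
    nonempty families only; its probability is 0.\<close>
  proof (cases "S = {}")
    case False
    have "measure_pmf.prob N S \<le> measure_pmf.prob N {B. B \<subseteq> \<Union>S}"
      by (intro measure_pmf.finite_measure_mono) auto
    also have "\<dots> \<le> measure_pmf.prob p (\<Union>S)"
      using \<open>?artstein\<close> False S assms(2) by (auto simp: union_set_def)
    also have "\<Union>S = {q. \<exists>B\<in>S. q \<in> B}" by auto
    finally show ?thesis .
  qed simp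
  then show "rel_pmf (\<lambda>B q. q \<in> B) N p"
    using assms by (subst rel_pmf_finite_iff_measure) (auto intro: finite_subset)
qed

text \<open>Uniqueness of limits along a proper filter forces the second marginal of the coupling to
  be \<open>N\<close>. The coupling lists the element before the set, hence the flip of the
  relation.\<close>

lemma selection_law_iff_rel_pmf:
  assumes "F \<noteq> bot" "\<And>B. (cprob E j (\<lambda>\<omega>. R \<omega> = B) \<longlongrightarrow> pmf N B) F"
  shows "selection_law E j R F p \<longleftrightarrow> rel_pmf (\<lambda>B q. q \<in> B) N p"
proof
  assume "selection_law E j R F p"
  then obtain W where W: "map_pmf fst W = p"
    "\<And>B. (cprob E j (\<lambda>\<omega>. R \<omega> = B) \<longlongrightarrow> pmf (map_pmf snd W) B) F"
    "AE (q, b) in measure_pmf W. q \<in> b"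
    unfolding selection_law_def by blast
  have "map_pmf snd W = N"
    by (rule pmf_eqI) (rule tendsto_unique[OF assms(1) W(2) assms(2)])
  then have "rel_pmf (\<lambda>q B. q \<in> B) p N"
    using W by (intro rel_pmf.intros[of W]) (auto simp: AE_measure_pmf_iff)
  then show "rel_pmf (\<lambda>B q. q \<in> B) N p"
    using pmf.rel_flip[of "\<lambda>B q. q \<in> B" p N] by (simp add: conversep_iff[abs_def])
next
  assume "rel_pmf (\<lambda>B q. q \<in> B) N p"
  then have "rel_pmf (\<lambda>q B. q \<in> B) p N"
    using pmf.rel_flip[of "\<lambda>B q. q \<in> B" p N] by (simp add: conversep_iff[abs_def])
  then obtain W where "\<And>q B. (q, B) \<in> set_pmf W \<Longrightarrow> q \<in> B" "map_pmf fst W = p" "map_pmf snd W = N"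
    by cases auto
  then show "selection_law E j R F p"
    using assms(2) unfolding selection_law_def
    by (intro exI[of _ W]) (auto simp: AE_measure_pmf_iff)
qed


section \<open>Limits of conditional laws\<close>

text \<open>Both properties hold at every \<open>s\<close>, not just at almost every one, so
  conditional probabilities can be passed to the limit along any filter.\<close>

locale cond_kernel =
  fixes E :: "('w, 'z) market_scheme" and j :: nat
  assumes prob_kern: "prob_space (kern E j s)"
    and sets_kern: "sets (kern E j s) = sets (students E)"
begin

lemma cprob_eq_sum:
  assumes X: "X \<in> students E \<rightarrow>\<^sub>M count_space D" and "finite D"
  shows "cprob E j (\<lambda>\<omega>. X \<omega> \<in> A) s = (\<Sum>x\<in>D \<inter> A. cprob E j (\<lambda>\<omega>. X \<omega> = x) s)"
proof -
  interpret prob_space "kern E j s" by (rule prob_kern)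
  have sets: "{\<omega> \<in> space (students E). X \<omega> = x} \<in> events" if "x \<in> D" for x
  proof -
    have "{\<omega> \<in> space (students E). X \<omega> = x} = X -` {x} \<inter> space (students E)" by auto
    then show ?thesis using measurable_sets[OF X, of "{x}"] that by (simp add: sets_kern)
  qed
  have "{\<omega> \<in> space (students E). X \<omega> \<in> A} = (\<Union>x\<in>D \<inter> A. {\<omega> \<in> space (students E). X \<omega> = x})"
    using measurable_space[OF X] by auto
  then show ?thesis
    unfolding cprob_def using sets assms(2)
    by (auto intro!: finite_measure_finite_Union simp: disjoint_family_on_def)
qed

lemma cprob_sum_eq_1:
  assumes "X \<in> students E \<rightarrow>\<^sub>M count_space D" "finite D"
  shows "(\<Sum>x\<in>D. cprob E j (\<lambda>\<omega>. X \<omega> = x) s) = 1"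
proof -
  have "cprob E j (\<lambda>\<omega>. X \<omega> \<in> UNIV) s = 1"
    using prob_space.prob_space[OF prob_kern, of s] sets_eq_imp_space_eq[OF sets_kern]
    by (simp add: cprob_def)
  then show ?thesis using cprob_eq_sum[OF assms, of UNIV s] by simp
qed

lemma cprob_eq_0:
  assumes "X \<in> students E \<rightarrow>\<^sub>M count_space D" "x \<notin> D"
  shows "cprob E j (\<lambda>\<omega>. X \<omega> = x) s = 0"
proof -
  have "{\<omega> \<in> space (students E). X \<omega> = x} = {}"
    using measurable_space[OF assms(1)] assms(2) by auto
  then show ?thesis by (simp only: cprob_def measure_empty)
qed

lemma cprob_tendsto_prob:
  assumes X: "X \<in> students E \<rightarrow>\<^sub>M count_space D" and "finite D"
    and P: "set_pmf P \<subseteq> D" "\<And>x. x \<in> D \<Longrightarrow> (cprob E j (\<lambda>\<omega>. X \<omega> = x) \<longlongrightarrow> pmf P x) F"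
  shows "(cprob E j (\<lambda>\<omega>. X \<omega> \<in> A) \<longlongrightarrow> measure_pmf.prob P A) F"
proof -
  have "measure_pmf.prob P A = measure_pmf.prob P (D \<inter> A)"
    using P(1) by (intro measure_pmf.finite_measure_eq_AE) (auto simp: AE_measure_pmf_iff)
  also have "\<dots> = (\<Sum>x\<in>D \<inter> A. pmf P x)"
    using \<open>finite D\<close> by (simp add: measure_measure_pmf_finite)
  finally show ?thesis
    unfolding cprob_eq_sum[OF X \<open>finite D\<close>, abs_def]
    using P(2) by (auto intro!: tendsto_sum)
qed

text \<open>No mass escapes in the limit because \<open>D\<close> is finite: the point probabilities
  sum to 1 at every \<open>s\<close>, and a finite sum commutes with limits.\<close>

lemma limit_law:
  assumes X: "X \<in> students E \<rightarrow>\<^sub>M count_space D" and "finite D"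
    and "F \<noteq> bot" "\<Lambda> \<subseteq> D"
    and lim: "\<And>x. x \<in> \<Lambda> \<Longrightarrow> \<exists>L. (cprob E j (\<lambda>\<omega>. X \<omega> = x) \<longlongrightarrow> L) F"
    and zero: "\<And>x. x \<in> D - \<Lambda> \<Longrightarrow> \<forall>\<^sub>F s in F. cprob E j (\<lambda>\<omega>. X \<omega> = x) s = 0"
  obtains P where "set_pmf P \<subseteq> \<Lambda>" "\<And>x. (cprob E j (\<lambda>\<omega>. X \<omega> = x) \<longlongrightarrow> pmf P x) F"
proof -
  have zero': "\<forall>\<^sub>F s in F. cprob E j (\<lambda>\<omega>. X \<omega> = x) s = 0" if "x \<notin> \<Lambda>" for x
    using zero[of x] cprob_eq_0[OF X, of x] that by (cases "x \<in> D") auto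
  define f where "f x = Lim F (cprob E j (\<lambda>\<omega>. X \<omega> = x))" for x
  have f: "(cprob E j (\<lambda>\<omega>. X \<omega> = x) \<longlongrightarrow> f x) F" for x
  proof -
    have "\<exists>L. (cprob E j (\<lambda>\<omega>. X \<omega> = x) \<longlongrightarrow> L) F"
      using lim zero' tendsto_eventually by (cases "x \<in> \<Lambda>") blast+
    then show ?thesis unfolding f_def using \<open>F \<noteq> bot\<close> by (metis tendsto_Lim)
  qed
  have "finite \<Lambda>" using assms finite_subset by auto
  moreover have "0 \<le> f x" for x
    by (rule tendsto_lowerbound[OF f _ \<open>F \<noteq> bot\<close>]) (simp add: cprob_def)
  moreover have f0: "f x = 0" if "x \<notin> \<Lambda>" for x
    using tendsto_unique[OF \<open>F \<noteq> bot\<close> f tendsto_eventually[OF zero'[OF that]]] .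
  moreover have "sum f \<Lambda> = 1"
  proof -
    have "((\<lambda>s. \<Sum>x\<in>D. cprob E j (\<lambda>\<omega>. X \<omega> = x) s) \<longlongrightarrow> sum f D) F"
      using f by (intro tendsto_sum)
    then have "sum f D = 1"
      unfolding cprob_sum_eq_1[OF X \<open>finite D\<close>] using \<open>F \<noteq> bot\<close> tendsto_const_iff by metis
    moreover have "sum f \<Lambda> = sum f D"
      using f0 assms by (intro sum.mono_neutral_left) auto
    ultimately show ?thesis by simp
  qed
  ultimately obtain P where "pmf P = f" "set_pmf P \<subseteq> \<Lambda>"
    by (rule pmf_of_finite_mass_function)
  then show ?thesis using that f by simp
qed

text \<open>When \<open>X\<close> lies in \<open>R\<close> almost surely,
  \<open>R \<subseteq> A\<close> forces \<open>X\<close> into \<open>A\<close>. It is enough that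
  this happens frequently: both sides converge, so a strict violation in the limit would persist
  eventually.\<close>

lemma limit_law_dominated:
  assumes R: "R \<in> students E \<rightarrow>\<^sub>M count_space (Pow D)" and X: "X \<in> students E \<rightarrow>\<^sub>M count_space D"
    and "finite D"
    and N: "set_pmf N \<subseteq> Pow D" "\<And>B. (cprob E j (\<lambda>\<omega>. R \<omega> = B) \<longlongrightarrow> pmf N B) F"
    and P: "set_pmf P \<subseteq> D" "\<And>x. x \<in> D \<Longrightarrow> (cprob E j (\<lambda>\<omega>. X \<omega> = x) \<longlongrightarrow> pmf P x) F"
    and freq: "\<exists>\<^sub>F s in F. cprob E j (\<lambda>\<omega>. X \<omega> \<in> R \<omega>) s = 1"
  shows "measure_pmf.prob N {B. B \<subseteq> A} \<le> measure_pmf.prob P A"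
proof (rule ccontr)
  have le: "cprob E j (\<lambda>\<omega>. R \<omega> \<in> {B. B \<subseteq> A}) s \<le> cprob E j (\<lambda>\<omega>. X \<omega> \<in> A) s"
    if one: "cprob E j (\<lambda>\<omega>. X \<omega> \<in> R \<omega>) s = 1" for s
  proof -
    interpret prob_space "kern E j s" by (rule prob_kern)
    have sp: "space (kern E j s) = space (students E)"
      using sets_kern by (rule sets_eq_imp_space_eq)
    \<comment> \<open>Probability 1 already makes the event measurable, since \<open>measure\<close>
      is 0 outside the sigma-algebra.\<close>
    have "AE \<omega> in kern E j s. \<omega> \<in> {\<omega> \<in> space (students E). X \<omega> \<in> R \<omega>}"
      using one by (intro AE_prob_1) (simp add: cprob_def)
    moreover have "{\<omega> \<in> space (students E). X \<omega> \<in> A} = X -` (A \<inter> D) \<inter> space (students E)"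
      using measurable_space[OF X] by auto
    then have "{\<omega> \<in> space (students E). X \<omega> \<in> A} \<in> events"
      using measurable_sets[OF X, of "A \<inter> D"] by (simp add: sets_kern)
    moreover from calculation(1) have "AE \<omega> in kern E j s.
      \<omega> \<in> {\<omega> \<in> space (students E). R \<omega> \<in> {B. B \<subseteq> A}} \<longrightarrow> \<omega> \<in> {\<omega> \<in> space (students E). X \<omega> \<in> A}"
      by eventually_elim auto
    ultimately show ?thesis
      unfolding cprob_def by (intro finite_measure_mono_AE)
  qed
  assume "\<not> measure_pmf.prob N {B. B \<subseteq> A} \<le> measure_pmf.prob P A"
  then obtain m where m: "measure_pmf.prob P A < m" "m < measure_pmf.prob N {B. B \<subseteq> A}"
    by (metis dense not_le)
  have "(cprob E j (\<lambda>\<omega>. X \<omega> \<in> A) \<longlongrightarrow> measure_pmf.prob P A) F"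
    by (rule cprob_tendsto_prob[OF X \<open>finite D\<close> P])
  then have "\<forall>\<^sub>F s in F. cprob E j (\<lambda>\<omega>. X \<omega> \<in> A) s < m"
    using m(1) by (rule order_tendstoD(2))
  moreover have "(cprob E j (\<lambda>\<omega>. R \<omega> \<in> {B. B \<subseteq> A}) \<longlongrightarrow> measure_pmf.prob N {B. B \<subseteq> A}) F"
    by (rule cprob_tendsto_prob[OF R _ N]) (simp add: \<open>finite D\<close>)
  then have "\<forall>\<^sub>F s in F. m < cprob E j (\<lambda>\<omega>. R \<omega> \<in> {B. B \<subseteq> A}) s"
    using m(2) by (rule order_tendstoD(1))
  ultimately have "\<forall>\<^sub>F s in F. cprob E j (\<lambda>\<omega>. X \<omega> \<in> R \<omega>) s \<noteq> 1"
    by eventually_elim (use le in force)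
  then show False using freq by (simp add: frequently_def)
qed

lemma lps_moment_limit:
  assumes R: "R \<in> students E \<rightarrow>\<^sub>M count_space (Pow D)"
    and "one_sided_limit_exists E j F (lps_moment E R (\<lambda>_. 1) (- \<infinity>) \<infinity> B)"
  shows "\<exists>L. (cprob E j (\<lambda>\<omega>. R \<omega> = B) \<longlongrightarrow> L) F"
proof -
  have "cexp E j (lps_moment E R (\<lambda>_. 1) (- \<infinity>) \<infinity> B) = cprob E j (\<lambda>\<omega>. R \<omega> = B)"
  proof
    fix s
    \<comment> \<open>The bounds are strict but infinite, so the constant value 1 satisfies them
      whatever the outcome is.\<close>
    have "lps_moment E R (\<lambda>_. 1) (- \<infinity>) \<infinity> B = indicator {\<omega>. R \<omega> = B}"
      by (auto simp: lps_moment_def fun_eq_iff indicator_def)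
    moreover have "{\<omega>. R \<omega> = B} \<inter> space (students E) = {\<omega> \<in> space (students E). R \<omega> = B}" by auto
    ultimately show "cexp E j (lps_moment E R (\<lambda>_. 1) (- \<infinity>) \<infinity> B) s = cprob E j (\<lambda>\<omega>. R \<omega> = B) s"
      using sets_eq_imp_space_eq[OF sets_kern, of s] by (simp add: cexp_def cprob_def)
  qed
  then show ?thesis using assms(2) by (simp add: one_sided_limit_exists_def)
qed

end

section \<open>Continuity of the law of local preferences\<close>

lemma cond_kernel_of_valid_market:
  assumes "valid_market E" "j \<in> schools E"
  shows "cond_kernel E j"
proof (rule cond_kernel.intro)
  fix s
  have "kern E j \<in> borel \<rightarrow>\<^sub>M prob_algebra (students E)"
    using assms by (auto simp: valid_market_def regular_cond_dist_def)
  from measurable_space[OF this, of s]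
  show "prob_space (kern E j s)" "sets (kern E j s) = sets (students E)"
    by (auto simp: space_prob_algebra)
qed

lemma finite_options_schools [simp]: "finite (options E)" "finite (schools E)"
  by (auto simp: options_def schools_def)

lemma finite_pref_rels: "finite (pref_rels E)"
  by (rule finite_subset[of _ "Pow (options E \<times> options E)"]) (auto simp: pref_rels_def)

text \<open>
  The budget sets on either side of the cutoff do not depend on the \<open>j\<close>-th score, because \<open>j\<close>
  itself is one of the schools that are added or removed.
\<close>

lemma local_pref_cong:
  assumes "j \<in> schools E"
    "{m \<in> schools E - {j}. cutoff E m \<le> score E m \<omega>} = {m \<in> schools E - {j}. cutoff E m \<le> score E m \<omega>'}"
    "pref E \<omega> = pref E \<omega>'"
  shows "local_pref E j \<omega> = local_pref E j \<omega>'"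
proof -
  have j: "j \<in> same_cutoff_schools E j" using assms(1) by (simp add: same_cutoff_schools_def)
  have "m \<in> budget E \<omega> \<longleftrightarrow> m \<in> budget E \<omega>'" if "m \<noteq> j" for m
    using assms(2) that by (auto simp: budget_def set_eq_iff)
  then have "budget_plus E j \<omega> = budget_plus E j \<omega>'" "budget_minus E j \<omega> = budget_minus E j \<omega>'"
    using j by (auto simp: budget_plus_def budget_minus_def) metis+
  then show ?thesis by (simp add: local_pref_def assms(3))
qed

text \<open>The type \<open>V\<close> takes finitely many values and determines the local
  preference. Continuity of types covers each value, and a finite sum of continuous functions is
  continuous.\<close>

lemma isCont_cprob_local_pref:
  assumes valid: "valid_market E" and j: "j \<in> schools E" and types: "continuity_of_types E j"
  shows "isCont (cprob E j (\<lambda>\<omega>. local_pref E j \<omega> = q)) (cutoff E j)"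
proof -
  interpret cond_kernel E j using valid j by (rule cond_kernel_of_valid_market)
  define T where "T \<omega> = {m \<in> schools E - {j}. cutoff E m \<le> score E m \<omega>}" for \<omega>
  define D where "D = Pow (schools E - {j}) \<times> pref_rels E"
  define V where "V \<omega> = (T \<omega>, pref E \<omega>)" for \<omega>
  \<comment> \<open>Since students with equal \<open>V\<close> have equal local preferences, lying
    in \<open>K\<close> is equivalent to having local preference \<open>q\<close>.\<close>
  define K where "K = {V \<omega> | \<omega>. local_pref E j \<omega> = q}"
  have fin: "finite D" by (simp add: D_def finite_pref_rels)
  have pref: "pref E \<in> students E \<rightarrow>\<^sub>M count_space (pref_rels E)"
    using valid by (simp add: valid_market_def)
  have score: "score E m \<in> borel_measurable (students E)" if "m \<in> schools E" for m
    using valid that by (simp add: valid_market_def)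
  have atom: "{\<omega> \<in> space (students E). T \<omega> = S} \<in> sets (students E)" for S
  proof -
    \<comment> \<open>The equivalences constrain \<open>S\<close> only on
      \<open>schools E - {j}\<close>; the added conjunct makes the event empty for every other
      \<open>S\<close>.\<close>
    have "{\<omega> \<in> space (students E). T \<omega> = S} =
      {\<omega> \<in> space (students E). S \<subseteq> schools E - {j} \<and>
         (\<forall>m\<in>schools E - {j}. cutoff E m \<le> score E m \<omega> \<longleftrightarrow> m \<in> S)}"
      by (auto simp: T_def)
    also have "\<dots> \<in> sets (students E)"
      using score by (intro sets.sets_Collect_conj sets.sets_Collect_const
        sets.sets_Collect_finite_All) (auto intro!: sets_Collect_single)
    finally show ?thesis .
  qed
  have V: "V \<in> students E \<rightarrow>\<^sub>M count_space D"
  proof (subst measurable_count_space_eq2[OF fin], intro conjI ballI)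
    show "V \<in> space (students E) \<rightarrow> D"
      using measurable_space[OF pref] by (auto simp: V_def D_def T_def)
    fix v assume "v \<in> D"
    then obtain S r where v: "v = (S, r)" "r \<in> pref_rels E" by (auto simp: D_def)
    have "V -` {v} \<inter> space (students E) =
      {\<omega> \<in> space (students E). T \<omega> = S} \<inter> (pref E -` {r} \<inter> space (students E))"
      by (auto simp: V_def v)
    also have "\<dots> \<in> sets (students E)"
      using atom measurable_sets[OF pref, of "{r}"] v(2) by auto
    finally show "V -` {v} \<inter> space (students E) \<in> sets (students E)" .
  qed
  have cont: "isCont (cprob E j (\<lambda>\<omega>. V \<omega> = v)) (cutoff E j)" if v_in: "v \<in> D" for v
  proof -
    obtain S r where v: "v = (S, r)" "S \<subseteq> schools E - {j}" "r \<in> pref_rels E"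
      using v_in by (auto simp: D_def)
    let ?A = "{\<omega> \<in> space (students E). \<forall>m\<in>schools E - {j}. cutoff E m \<le> score E m \<omega> \<longleftrightarrow> m \<in> S}"
    have "?A \<in> other_score_events E j" using v by (auto simp: other_score_events_def)
    then have "isCont (cprob E j (\<lambda>\<omega>. \<omega> \<in> ?A \<and> pref E \<omega> = r)) (cutoff E j)"
      using types v by (auto simp: continuity_of_types_def)
    moreover have "{\<omega> \<in> space (students E). \<omega> \<in> ?A \<and> pref E \<omega> = r} =
      {\<omega> \<in> space (students E). V \<omega> = v}"
      using v by (auto simp: V_def T_def)
    ultimately show ?thesis by (simp add: cprob_def[abs_def])
  qed
  have "local_pref E j \<omega> = local_pref E j \<omega>'" if "V \<omega> = V \<omega>'" for \<omega> \<omega>'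
    using that by (intro local_pref_cong[OF j]) (simp_all add: V_def T_def)
  then have "local_pref E j \<omega> = q \<longleftrightarrow> V \<omega> \<in> K" for \<omega>
    unfolding K_def by blast
  then have "cprob E j (\<lambda>\<omega>. local_pref E j \<omega> = q) = (\<lambda>s. \<Sum>v\<in>D \<inter> K. cprob E j (\<lambda>\<omega>. V \<omega> = v) s)"
    using cprob_eq_sum[OF V fin, of K] by presburger
  then show ?thesis using cont by (auto intro!: continuous_sum)
qed

section \<open>Scores close to the cutoff\<close>

text \<open>An open set meeting the support has positive probability under the law of the score, so
  an almost sure property cannot fail on all of it. This turns almost sure statements about students
  into actual scores.\<close>

lemma ex_score_in_support_interval:
  assumes valid: "valid_market E" "j \<in> schools E"
    and AE: "AE \<omega> in students E. P (score E j \<omega>)"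
    and U: "open U" "U \<inter> score_support E j \<noteq> {}"
  shows "\<exists>s\<in>U. P s"
proof (rule ccontr)
  assume none: "\<not> (\<exists>s\<in>U. P s)"
  have meas: "score E j \<in> borel_measurable (students E)"
    using valid by (simp add: valid_market_def)
  obtain s where "s \<in> U" "s \<in> score_support E j" using U by auto
  then have "0 < emeasure (score_law E j) U"
    using U by (auto simp: score_support_def measure_support_def)
  then have pos: "0 < emeasure (students E) (score E j -` U \<inter> space (students E))"
    using U meas by (simp add: score_law_def emeasure_distr)
  have "AE \<omega> in students E. \<omega> \<notin> score E j -` U \<inter> space (students E)"
    using AE by eventually_elim (use none in auto)
  then have "emeasure (students E) (score E j -` U \<inter> space (students E)) = 0"
    using measurable_sets[OF meas borel_open[OF U(1)]]
    by (subst (asm) AE_iff_measurable[OF _ refl]) (auto simp: Int_def conj_commute)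
  then show False using pos by simp
qed

text \<open>Sharpness is an almost sure statement and says nothing about a prescribed score, but it
  provides a suitable score in every short interval next to the cutoff, which is frequency along
  either one-sided filter.\<close>

lemma frequently_local_pref_in_set:
  assumes valid: "valid_market E" "j \<in> schools E" and sharp: "sharp_local_pref_sets E j R"
    and F: "F \<in> {at_left (cutoff E j), at_right (cutoff E j)}"
  shows "\<exists>\<^sub>F s in F. cprob E j (\<lambda>\<omega>. local_pref E j \<omega> \<in> R \<omega>) s = 1"
proof -
  let ?c = "cutoff E j" and ?P = "\<lambda>s. cprob E j (\<lambda>\<omega>. local_pref E j \<omega> \<in> R \<omega>) s = 1"
  obtain \<delta> where \<delta>: "0 < \<delta>" "AE \<omega> in students E. \<bar>score E j \<omega> - ?c\<bar> < \<delta> \<longrightarrow> ?P (score E j \<omega>)"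
    using sharp unfolding sharp_local_pref_sets_def by blast
  obtain \<delta>' where \<delta>': "0 < \<delta>'" "{?c - \<delta>' .. ?c + \<delta>'} \<subseteq> score_support E j"
    using valid by (auto simp: valid_market_def)
  \<comment> \<open>Within \<open>\<delta>'\<close> of the cutoff every score is in the support, so
    the midpoint witnesses that the interval meets it; within \<open>\<delta>\<close> sharpness
    applies.\<close>
  have ex: "\<exists>s\<in>{a<..<b}. ?P s" if "a < b" "?c - min \<delta> \<delta>' \<le> a" "b \<le> ?c + min \<delta> \<delta>'" for a b
  proof -
    have "(a + b) / 2 \<in> {a<..<b} \<inter> score_support E j"
      using that \<delta>'(2) by (auto simp: field_simps min_def split: if_splits)
    then have "{a<..<b} \<inter> score_support E j \<noteq> {}" by blast
    from ex_score_in_support_interval[OF valid \<delta>(2) _ this]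
    show ?thesis using that by force
  qed
  show ?thesis
  proof (cases "F = at_right ?c")
    case True
    have "\<exists>s>?c. s < b \<and> ?P s" if "?c < b" for b
      using ex[of ?c "min b (?c + min \<delta> \<delta>')"] that \<delta>(1) \<delta>'(1) by force
    then show ?thesis
      unfolding True frequently_def eventually_at_right_field by blast
  next
    case False
    then have "F = at_left ?c" using F by simp
    moreover have "\<exists>s>b. s < ?c \<and> ?P s" if "b < ?c" for b
      using ex[of "max b (?c - min \<delta> \<delta>')" ?c] that \<delta>(1) \<delta>'(1) by force
    ultimately show ?thesis
      unfolding frequently_def by (simp add: eventually_at_left_field)
  qed
qed

section \<open>Sharp bounds on either side and their combination\<close>

text \<open>The filter \<open>F\<close> treats both sides of the cutoff at once. The laws of
  \<open>R\<close> converge along \<open>F\<close> to a law \<open>N\<close> carried by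
  \<open>\<Lambda>\<close>, whose selections are described by Artstein's inequalities; the true law
  meets these by domination in the limit.\<close>

lemma one_sided_sharp_bounds:
  assumes valid: "valid_market E" "j \<in> schools E" and types: "continuity_of_types E j"
    and sharp: "sharp_local_pref_sets E j R"
    and F: "F \<in> {at_left (cutoff E j), at_right (cutoff E j)}"
    and supp: "\<forall>\<^sub>F s in F. lps_support E j R s = \<Lambda>" and \<Lambda>: "\<Lambda> \<subseteq> Pow (options E \<times> options E)"
    and lim: "\<And>A. A \<in> \<Lambda> \<Longrightarrow>
      one_sided_limit_exists E j F (lps_moment E R (\<lambda>_. 1) (- \<infinity>) \<infinity> A)"
  shows "set_pmf p \<subseteq> options E \<times> options E \<Longrightarrow> selection_law E j R F p \<longleftrightarrow>
      (\<forall>A\<in>union_set \<Lambda>. Lim F (cprob E j (\<lambda>\<omega>. R \<omega> \<subseteq> A)) \<le> measure_pmf.prob p A)"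
    and "\<lbrakk>set_pmf p \<subseteq> options E \<times> options E; is_true_law E j p\<rbrakk> \<Longrightarrow> selection_law E j R F p"
proof -
  interpret cond_kernel E j using valid by (rule cond_kernel_of_valid_market)
  let ?D = "options E \<times> options E"
  have "F \<noteq> bot"
    using F trivial_limit_at_left_real trivial_limit_at_right_real by (metis insertE singletonD)
  have "F \<le> at (cutoff E j)" using F by (auto intro: at_le)
  have R: "R \<in> students E \<rightarrow>\<^sub>M count_space (Pow ?D)"
    and lp: "local_pref E j \<in> students E \<rightarrow>\<^sub>M count_space ?D"
    using sharp by (simp_all add: sharp_local_pref_sets_def)
  \<comment> \<open>Moments are controlled only for members of \<open>\<Lambda>\<close>; any other
    set eventually has probability exactly 0, which supplies its limit.\<close>
  have zero: "\<forall>\<^sub>F s in F. cprob E j (\<lambda>\<omega>. R \<omega> = B) s = 0" if "B \<in> Pow ?D - \<Lambda>" for B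
    using supp
  proof eventually_elim
    case (elim s)
    then have "B \<notin> lps_support E j R s" using that by simp
    then have "cprob E j (\<lambda>\<omega>. R \<omega> = B) s \<le> 0" using that by (simp add: lps_support_def)
    then show ?case by (simp add: cprob_def measure_le_0_iff)
  qed
  obtain N where N: "set_pmf N \<subseteq> \<Lambda>" "\<And>B. (cprob E j (\<lambda>\<omega>. R \<omega> = B) \<longlongrightarrow> pmf N B) F"
    by (rule limit_law[OF R _ \<open>F \<noteq> bot\<close> \<Lambda> lps_moment_limit[OF R lim] zero]) auto
  have fin\<Lambda>: "finite \<Lambda>" using \<Lambda> by (rule finite_subset) simp
  have N_Pow: "set_pmf N \<subseteq> Pow ?D" using N(1) \<Lambda> by simp
  have "(cprob E j (\<lambda>\<omega>. R \<omega> \<in> {B. B \<subseteq> A}) \<longlongrightarrow> measure_pmf.prob N {B. B \<subseteq> A}) F" for A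
    by (rule cprob_tendsto_prob[OF R _ N_Pow N(2)]) simp
  then have Lim: "Lim F (cprob E j (\<lambda>\<omega>. R \<omega> \<subseteq> A)) = measure_pmf.prob N {B. B \<subseteq> A}" for A
    by (intro tendsto_Lim[OF \<open>F \<noteq> bot\<close>]) simp
  show iff: "selection_law E j R F p \<longleftrightarrow>
      (\<forall>A\<in>union_set \<Lambda>. Lim F (cprob E j (\<lambda>\<omega>. R \<omega> \<subseteq> A)) \<le> measure_pmf.prob p A)"
    if "set_pmf p \<subseteq> ?D" for p
  proof -
    have "finite (set_pmf p)" using that by (rule finite_subset) simp
    then show ?thesis
      unfolding Lim selection_law_iff_rel_pmf[OF \<open>F \<noteq> bot\<close> N(2)]
      by (rule rel_pmf_selection_iff[OF fin\<Lambda> N(1)])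
  qed
  show "selection_law E j R F p" if p: "set_pmf p \<subseteq> ?D" "is_true_law E j p"
  proof -
    \<comment> \<open>Continuity identifies the one-sided limit of the law of local preferences with
      the law at the cutoff itself.\<close>
    have "(cprob E j (\<lambda>\<omega>. local_pref E j \<omega> = q) \<longlongrightarrow> pmf p q) F" for q
    proof -
      have "pmf p q = cprob E j (\<lambda>\<omega>. local_pref E j \<omega> = q) (cutoff E j)"
        using p(2) unfolding is_true_law_def by blast
      then show ?thesis
        using isCont_cprob_local_pref[OF valid types, of q] \<open>F \<le> at (cutoff E j)\<close>
        unfolding isCont_def by (auto intro: tendsto_mono)
    qed
    then have "measure_pmf.prob N {B. B \<subseteq> A} \<le> measure_pmf.prob p A" for A
      by (intro limit_law_dominated[OF R lp _ N_Pow N(2) p(1) _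
            frequently_local_pref_in_set[OF valid sharp F]]) simp_all
    then show ?thesis unfolding iff[OF p(1)] Lim by blast
  qed
qed

text \<open>Regroups the three cases by side of the cutoff: a bound by a maximum is the conjunction
  of both bounds, so each side imposes its own bound on its own family.\<close>

lemma one_sided_bounds_iff:
  fixes f g h :: "'a \<Rightarrow> real"
  shows "(\<forall>A\<in>U \<union> V. (A \<in> U \<inter> V \<longrightarrow> h A \<ge> max (f A) (g A)) \<and>
      (A \<in> U - V \<longrightarrow> h A \<ge> f A) \<and> (A \<in> V - U \<longrightarrow> h A \<ge> g A)) \<longleftrightarrow>
    (\<forall>A\<in>U. f A \<le> h A) \<and> (\<forall>A\<in>V. g A \<le> h A)"
  by auto

text \<open>The kernel at the cutoff is a probability measure and the local preference has finitely
  many values, so its law there is a \<open>pmf\<close>. It is the witness for the claim that the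
  sharp set contains the true law.\<close>

lemma ex_true_law:
  assumes "valid_market E" "j \<in> schools E" "sharp_local_pref_sets E j R"
  obtains p where "set_pmf p \<subseteq> options E \<times> options E" "is_true_law E j p"
proof -
  interpret cond_kernel E j using assms(1,2) by (rule cond_kernel_of_valid_market)
  have lp: "local_pref E j \<in> students E \<rightarrow>\<^sub>M count_space (options E \<times> options E)"
    using assms(3) by (simp add: sharp_local_pref_sets_def)
  let ?f = "\<lambda>q. cprob E j (\<lambda>\<omega>. local_pref E j \<omega> = q) (cutoff E j)"
  have f: "finite (options E \<times> options E)" "\<And>q. 0 \<le> ?f q"
    "\<And>q. q \<notin> options E \<times> options E \<Longrightarrow> ?f q = 0" "sum ?f (options E \<times> options E) = 1"
    using cprob_eq_0[OF lp] cprob_sum_eq_1[OF lp] by (simp_all add: cprob_def)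
  from f obtain p where "pmf p = ?f" "set_pmf p \<subseteq> options E \<times> options E"
    by (rule pmf_of_finite_mass_function)
  then show ?thesis using that by (simp add: is_true_law_def)
qed

theorem proposition4:
  fixes E :: "'w market"
    and j k :: nat
    and R :: "'w \<Rightarrow> (nat \<times> nat) set"
    and \<Lambda>p \<Lambda>m :: "(nat \<times> nat) set set"
  assumes "valid_market E"
    and "(j, k) \<in> comparable_pairs E"
    and "continuity_of_types E j"
    and "sharp_local_pref_sets E j R"
    and "dist_local_pref_sets E j R \<Lambda>p \<Lambda>m"
  shows "sharp_set E j R =
      {p. set_pmf p \<subseteq> options E \<times> options E \<and>
          (\<forall>A \<in> union_set \<Lambda>p \<union> union_set \<Lambda>m.
             (A \<in> union_set \<Lambda>p \<inter> union_set \<Lambda>m \<longrightarrow>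
                measure_pmf.prob p A \<ge>
                  max (cprob_right E j (\<lambda>\<omega>. R \<omega> \<subseteq> A)) (cprob_left E j (\<lambda>\<omega>. R \<omega> \<subseteq> A))) \<and>
             (A \<in> union_set \<Lambda>p - union_set \<Lambda>m \<longrightarrow>
                measure_pmf.prob p A \<ge> cprob_right E j (\<lambda>\<omega>. R \<omega> \<subseteq> A)) \<and>
             (A \<in> union_set \<Lambda>m - union_set \<Lambda>p \<longrightarrow>
                measure_pmf.prob p A \<ge> cprob_left E j (\<lambda>\<omega>. R \<omega> \<subseteq> A)))}
    \<and> (\<exists>p \<in> sharp_set E j R. is_true_law E j p)"
proof -
  let ?c = "cutoff E j" and ?D = "options E \<times> options E"
  have j: "j \<in> schools E" using assms(2) by (simp add: comparable_pairs_def)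
  have one: "(\<lambda>_. 1) \<in> test_funs E" using assms(1) by (simp add: valid_market_def)
  obtain \<epsilon> where \<epsilon>: "0 < \<epsilon>" "\<And>e. 0 \<le> e \<Longrightarrow> e < \<epsilon> \<Longrightarrow> lps_support E j R (?c + e) = \<Lambda>p"
    "\<And>e. 0 < e \<Longrightarrow> e < \<epsilon> \<Longrightarrow> lps_support E j R (?c - e) = \<Lambda>m"
    using assms(5) unfolding dist_local_pref_sets_def by blast
  have "lps_support E j R s = \<Lambda>p" if "?c < s" "s < ?c + \<epsilon>" for s
    using \<epsilon>(2)[of "s - ?c"] that by simp
  then have right: "\<forall>\<^sub>F s in at_right ?c. lps_support E j R s = \<Lambda>p"
    using \<epsilon>(1) unfolding eventually_at_right_field by (intro exI[of _ "?c + \<epsilon>"]) simp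
  have "lps_support E j R s = \<Lambda>m" if "?c - \<epsilon> < s" "s < ?c" for s
    using \<epsilon>(3)[of "?c - s"] that by simp
  then have left: "\<forall>\<^sub>F s in at_left ?c. lps_support E j R s = \<Lambda>m"
    using \<epsilon>(1) unfolding eventually_at_left_field by (intro exI[of _ "?c - \<epsilon>"]) simp
  \<comment> \<open>The offset \<open>\<epsilon> / 2\<close> lies in both windows, where the
    collections are values of \<open>lps_support\<close> and hence consist of subsets of
    \<open>?D\<close>.\<close>
  have \<Lambda>: "\<Lambda>p \<subseteq> Pow ?D" "\<Lambda>m \<subseteq> Pow ?D"
    using \<epsilon>(1) \<epsilon>(2)[of "\<epsilon> / 2"] \<epsilon>(3)[of "\<epsilon> / 2"] by (auto simp: lps_support_def)
  have lim: "A \<in> \<Lambda>p \<Longrightarrow> one_sided_limit_exists E j (at_right ?c) (lps_moment E R (\<lambda>_. 1) (- \<infinity>) \<infinity> A)"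
    "A \<in> \<Lambda>m \<Longrightarrow> one_sided_limit_exists E j (at_left ?c) (lps_moment E R (\<lambda>_. 1) (- \<infinity>) \<infinity> A)" for A
    using assms(5) one unfolding dist_local_pref_sets_def by simp_all
  note right_bounds = one_sided_sharp_bounds[OF assms(1) j assms(3,4) _ right \<Lambda>(1) lim(1)]
  note left_bounds = one_sided_sharp_bounds[OF assms(1) j assms(3,4) _ left \<Lambda>(2) lim(2)]
  \<comment> \<open>The one-sided equivalences are stated for \<open>p\<close> carried by
    \<open>?D\<close>; \<open>conj_cong\<close> makes the first conjunct available to prove
    them.\<close>
  have mem: "p \<in> sharp_set E j R \<longleftrightarrow> set_pmf p \<subseteq> ?D \<and>
      (\<forall>A\<in>union_set \<Lambda>p. cprob_right E j (\<lambda>\<omega>. R \<omega> \<subseteq> A) \<le> measure_pmf.prob p A) \<and>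
      (\<forall>A\<in>union_set \<Lambda>m. cprob_left E j (\<lambda>\<omega>. R \<omega> \<subseteq> A) \<le> measure_pmf.prob p A)" for p
    unfolding sharp_set_def cprob_right_def cprob_left_def mem_Collect_eq
    by (intro conj_cong right_bounds(1) left_bounds(1)) simp_all
  obtain p where p: "set_pmf p \<subseteq> ?D" "is_true_law E j p"
    using assms(1) j assms(4) by (rule ex_true_law)
  have "p \<in> sharp_set E j R"
    unfolding sharp_set_def mem_Collect_eq
    by (intro conjI p(1) right_bounds(2)[OF _ _ p] left_bounds(2)[OF _ _ p]) simp_all
  with p(2) have true_law: "\<exists>p\<in>sharp_set E j R. is_true_law E j p" by (rule bexI)
  show ?thesis
    unfolding one_sided_bounds_iff
    by (intro conjI set_eqI true_law) (simp only: mem mem_Collect_eq)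
qed

end
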